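(* Let $M\ge 2$, let $C$ be an open box included in $\mathbb{R}_{++}^{M}$, and let $\sum_{k=1}^{N}\lambda_k\delta_{\mathbf{x}_k}$ and $\sum_{k=1}^{N}\lambda_k\delta_{\mathbf{y}_k}$ be two discrete probability measures supported at points in $C$. If $\sum_{k=1}^{N}\lambda_k\delta_{\mathbf{x}_k}\prec_{L^{\downarrow}}\sum_{k=1}^{N}\lambda_k\delta_{\mathbf{y}_k}$, then $$\sum_{k=1}^{N}\lambda_k\Phi(\mathbf{y}_k)\ge\sum_{k=1}^{N}\lambda_k\Phi(\mathbf{x}_k)$$ for every $2$-box monotone convex function $\Phi:C\to\mathbb{R}$, while if $\sum_{k=1}^{N}\lambda_k\delta_{\mathbf{x}_k}\prec_{R^{\uparrow}}\sum_{k=1}^{N}\lambda_k\delta_{\mathbf{y}_k}$, then for every such $\Phi$ the inequality works in the opposite direction, that is, $\sum_{k=1}^{N}\lambda_k\Phi(\mathbf{y}_k)\le\sum_{k=1}^{N}\lambda_k\Phi(\mathbf{x}_k)$.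
   Context: $\mathbb{R}^M$ carries the coordinatewise order; $\mathbb{R}_{++}^{M}=\{\mathbf{x}: x_1,\dots,x_M>0\}$. An open box is a product of $M$ open intervals. A function $\Phi:C\to\mathbb{R}$ is $2$-box monotone if for all indices $1\le i<j\le M$ and every nondegenerate $2$-dimensional box contained in $C$ of the form $\{u_1\}\times\cdots\times[v_i,w_i]\times\cdots\times[v_j,w_j]\times\cdots\times\{u_M\}$ (intervals in the $i$th and $j$th positions, with $v_i<w_i$, $v_j<w_j$, and singletons elsewhere) one has $$\Phi(u_1,\dots,v_i,\dots,v_j,\dots,u_M)-\Phi(u_1,\dots,v_i,\dots,w_j,\dots,u_M)-\Phi(u_1,\dots,w_i,\dots,v_j,\dots,u_M)+\Phi(u_1,\dots,w_i,\dots,w_j,\dots,u_M)\ge 0.$$ Weights satisfy $\lambda_k\in(0,1]$ and $\sum_{k=1}^N\lambda_k=1$; $\delta_{\mathbf{x}}$ is the Dirac measure at $\mathbf{x}$. The relations refer to the listed strings of points (repetitions allowed). Consider the conditions (i) $\sum_{k=1}^{n}\lambda_k\mathbf{x}_k\le\sum_{k=1}^{n}\lambda_k\mathbf{y}_k$ for all $n\in\{1,\dots,N\}$; (ii) $\sum_{k=1}^{N}\lambda_k\mathbf{x}_k=\sum_{k=1}^{N}\lambda_k\mathbf{y}_k$. Then $\sum\lambda_k\delta_{\mathbf{x}_k}\prec_{L^{\downarrow}}\sum\lambda_k\delta_{\mathbf{y}_k}$ means $\mathbf{x}_1\ge\cdots\ge\mathbf{x}_N$, (i) and (ii); $\prec_{R^{\uparrow}}$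 means $\mathbf{y}_1\le\cdots\le\mathbf{y}_N$, (i) and (ii). *)

theory Defs
  imports "HOL-Analysis.Analysis"
begin

text \<open>The intervals are arbitrary open intervals, bounded or not, so that the open
  positive orthant is itself an open box; \<^const>\<open>box\<close> covers only bounded ones.\<close>

definition open_box :: "(real ^ 'n) set \<Rightarrow> bool" where
  "open_box C \<longleftrightarrow>
     (\<exists>I :: 'n \<Rightarrow> real set.
        (\<forall>i. open (I i) \<and> is_interval (I i)) \<and> C = {x. \<forall>i. x $ i \<in> I i})"

definition replace2 :: "real ^ 'n \<Rightarrow> 'n \<Rightarrow> real \<Rightarrow> 'n \<Rightarrow> real \<Rightarrow> real ^ 'n" where
  "replace2 u i s j t = (\<chi> l. if l = i then s else if l = j then t else u $ l)"

text \<open>The index type carries no order. Both the box and the inequality below are symmetric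
  under exchanging the two coordinates, so unordered pairs \<open>i \<noteq> j\<close> stand for \<open>i < j\<close>.\<close>

definition two_box_monotone_on ::
    "(real ^ 'n) set \<Rightarrow> (real ^ 'n \<Rightarrow> real) \<Rightarrow> bool" where
  "two_box_monotone_on C \<Phi> \<longleftrightarrow>
     (\<forall>i j u vi wi vj wj.
        i \<noteq> j \<and> vi < wi \<and> vj < wj \<and>
        {replace2 u i s j t | s t. s \<in> {vi..wi} \<and> t \<in> {vj..wj}} \<subseteq> C \<longrightarrow>
        \<Phi> (replace2 u i vi j vj) - \<Phi> (replace2 u i vi j wj)
          - \<Phi> (replace2 u i wi j vj) + \<Phi> (replace2 u i wi j wj) \<ge> 0)"

text \<open>The majorization relations depend on the listing of the points, hence take the strings
  of weights and points (indexed by \<open>{1..N}\<close>) rather than the measures they represent.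
  The order \<open>\<le>\<close> on \<open>real ^ 'n\<close> is the coordinatewise one.\<close>

definition weighted_sums_dominated ::
    "nat \<Rightarrow> (nat \<Rightarrow> real) \<Rightarrow> (nat \<Rightarrow> real ^ 'n) \<Rightarrow> (nat \<Rightarrow> real ^ 'n) \<Rightarrow> bool" where
  "weighted_sums_dominated N lam x y \<longleftrightarrow>
     (\<forall>n\<in>{1..N}. (\<Sum>k=1..n. lam k *\<^sub>R x k) \<le> (\<Sum>k=1..n. lam k *\<^sub>R y k)) \<and>
     (\<Sum>k=1..N. lam k *\<^sub>R x k) = (\<Sum>k=1..N. lam k *\<^sub>R y k)"

definition majorized_L_down ::
    "nat \<Rightarrow> (nat \<Rightarrow> real) \<Rightarrow> (nat \<Rightarrow> real ^ 'n) \<Rightarrow> (nat \<Rightarrow> real ^ 'n) \<Rightarrow> bool" where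
  "majorized_L_down N lam x y \<longleftrightarrow>
     (\<forall>k\<in>{1..<N}. x k \<ge> x (Suc k)) \<and> weighted_sums_dominated N lam x y"

definition majorized_R_up ::
    "nat \<Rightarrow> (nat \<Rightarrow> real) \<Rightarrow> (nat \<Rightarrow> real ^ 'n) \<Rightarrow> (nat \<Rightarrow> real ^ 'n) \<Rightarrow> bool" where
  "majorized_R_up N lam x y \<longleftrightarrow>
     (\<forall>k\<in>{1..<N}. y k \<le> y (Suc k)) \<and> weighted_sums_dominated N lam x y"

end

theory Submission
  imports Defs
begin

text \<open>The inequality is a subgradient estimate followed by summation by parts, and the whole
  matter is to have a subgradient of \<open>\<Phi>\<close> that is an isotone function of the point.

  For smooth \<open>\<Phi>\<close> the gradient will do: \<open>\<partial>\<^sub>i \<Phi>\<close> increases in the coordinate \<open>i\<close> by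
  convexity and in every other coordinate by 2-box monotonicity. For general \<open>\<Phi>\<close> the vector \<open>p x\<close>
  of the right partial derivatives takes its place. Isotony survives, because it already holds for
  the increments \<open>\<Phi> (a + t e\<^sub>i) - \<Phi> a\<close> (\<open>increment_mono\<close>). That \<open>p x\<close> is a subgradient fails
  for a convex function in general, for example for \<open>\<bar>u - v\<bar>\<close>; here it holds for the following
  reason. The directional derivative \<open>D\<close> of \<open>\<Phi>\<close> at \<open>x\<close> is sublinear, and on the positive
  orthant 2-box monotonicity makes it superadditive over the coordinates; hence it agrees there with
  the linear form \<open>h \<mapsto> p x \<bullet> h\<close>. Splitting \<open>h\<close> into its positive part \<open>h\<^sup>+\<close> and its
  negative part \<open>h\<^sup>-\<close>, subadditivity yields \<open>D h \<ge> D h\<^sup>+ - D h\<^sup>- = p x \<bullet> h\<close> for every \<open>h\<close>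
  (\<open>isotone_subgradient\<close>).

  If now the points \<open>x k\<close> decrease, then so do the vectors \<open>p (x k)\<close>. The partial sums of the
  vectors \<open>lam k *\<^sub>R (y k - x k)\<close> are nonnegative and the total is zero, so summation by parts
  (\<open>antimono_weighted_sum_ge\<close>) shows that \<open>\<Sum>k. lam k * (p (x k) \<bullet> (y k - x k))\<close> is
  nonnegative, and this is a lower bound of the difference of the two sides. If instead the points
  \<open>y k\<close> increase, the same argument applies to the subgradients at the \<open>y k\<close>.\<close>

section \<open>Open boxes\<close>

lemma open_box_imp_open:
  assumes "open_box C"
  shows "open C"
  using assms unfolding open_box_def by (auto intro: open_vector_box)

text \<open>An open box is a product of intervals, so membership can be tested in each coordinate with
  different bounding points. This covers the order intervals as well as the points that are composed
  of coordinates of several points of the box.\<close>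

lemma open_box_memI:
  fixes C :: "(real ^ 'n) set"
  assumes "open_box C"
    and "\<And>i. \<exists>u\<in>C. \<exists>v\<in>C. u $ i \<le> w $ i \<and> w $ i \<le> v $ i"
  shows "w \<in> C"
proof -
  obtain I :: "'n \<Rightarrow> real set" where I: "\<And>i. is_interval (I i)" and C: "C = {x. \<forall>i. x $ i \<in> I i}"
    using assms(1) unfolding open_box_def by metis
  have "w $ i \<in> I i" for i
  proof -
    obtain u v where "u \<in> C" "v \<in> C" "u $ i \<le> w $ i" "w $ i \<le> v $ i"
      using assms(2) by blast
    with I[of i] show ?thesis
      unfolding C is_interval_1 by blast
  qed
  then show ?thesis
    unfolding C by simp
qed

lemma eventually_add_scaleR_mem:
  fixes x v :: "'a::real_normed_vector"
  assumes "open C" "x \<in> C"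
  shows "\<forall>\<^sub>F t in at_right 0. x + t *\<^sub>R v \<in> C"
proof -
  have "((\<lambda>t. x + t *\<^sub>R v) \<longlongrightarrow> x + 0 *\<^sub>R v) (at_right 0)"
    by (intro tendsto_intros)
  then show ?thesis
    using assms by (intro topological_tendstoD) auto
qed

section \<open>Right directional derivatives of convex functions\<close>

text \<open>The difference quotients of a convex function decrease as the step shrinks, which allows
  an infimum in place of the limit.\<close>

definition right_deriv ::
    "('a::real_vector) set \<Rightarrow> ('a \<Rightarrow> real) \<Rightarrow> 'a \<Rightarrow> 'a \<Rightarrow> real" where
  "right_deriv C f x v = (INF t\<in>{t. 0 < t \<and> x + t *\<^sub>R v \<in> C}. (f (x + t *\<^sub>R v) - f x) / t)"

lemma convex_slope_mono:
  fixes x v :: "'a::real_vector"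
  assumes "convex_on C f" "x \<in> C" "x + t *\<^sub>R v \<in> C" "0 < s" "s \<le> t"
  shows "(f (x + s *\<^sub>R v) - f x) / s \<le> (f (x + t *\<^sub>R v) - f x) / t"
proof -
  have t: "0 < t" using assms by simp
  have eq: "x + s *\<^sub>R v = (1 - s / t) *\<^sub>R x + (s / t) *\<^sub>R (x + t *\<^sub>R v)"
    using t by (simp add: algebra_simps)
  have "f (x + s *\<^sub>R v) \<le> (1 - s / t) * f x + (s / t) * f (x + t *\<^sub>R v)"
    unfolding eq by (rule convex_onD[OF assms(1)]) (use assms t in auto)
  also have "\<dots> = f x + s * ((f (x + t *\<^sub>R v) - f x) / t)"
    using t by (simp add: field_simps)
  finally have "f (x + s *\<^sub>R v) - f x \<le> s * ((f (x + t *\<^sub>R v) - f x) / t)"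
    by simp
  then show ?thesis
    using \<open>0 < s\<close> by (simp add: pos_divide_le_eq mult.commute)
qed

text \<open>A difference quotient to the left bounds all those to the right from below; without this
  bound the infimum in \<^const>\<open>right_deriv\<close> would be meaningless.\<close>

lemma convex_slope_bdd_below:
  fixes x v :: "'a::real_normed_vector"
  assumes "convex_on C f" "open C" "x \<in> C"
  shows "bdd_below ((\<lambda>t. (f (x + t *\<^sub>R v) - f x) / t) ` {t. 0 < t \<and> x + t *\<^sub>R v \<in> C})"
proof -
  have "\<forall>\<^sub>F r in at_right 0. 0 < r \<and> x + r *\<^sub>R (-v) \<in> C"
    by (intro eventually_conj eventually_add_scaleR_mem[OF assms(2,3)] eventually_at_right_less)
  then obtain r where r: "0 < r" "x + r *\<^sub>R (-v) \<in> C"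
    using eventually_happens'[OF trivial_limit_at_right_real] by blast
  let ?z = "x + r *\<^sub>R (-v)"
  have "(f x - f ?z) / r \<le> (f (x + t *\<^sub>R v) - f x) / t"
    if t: "0 < t" "x + t *\<^sub>R v \<in> C" for t
  proof -
    have eq: "?z + (r + t) *\<^sub>R v = x + t *\<^sub>R v" "?z + r *\<^sub>R v = x"
      by (simp_all add: algebra_simps)
    have "?z + (r + t) *\<^sub>R v \<in> C"
      unfolding eq by (rule t(2))
    then have "(f (?z + r *\<^sub>R v) - f ?z) / r \<le> (f (?z + (r + t) *\<^sub>R v) - f ?z) / (r + t)"
      by (rule convex_slope_mono[OF assms(1) r(2)]) (use r t in auto)
    then show ?thesis
      unfolding eq using r t by (simp add: field_simps)
  qed
  then show ?thesis
    by (intro bdd_belowI2) auto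
qed

lemma right_deriv_le_slope:
  fixes x v :: "'a::real_normed_vector"
  assumes "convex_on C f" "open C" "x \<in> C" "0 < t" "x + t *\<^sub>R v \<in> C"
  shows "right_deriv C f x v \<le> (f (x + t *\<^sub>R v) - f x) / t"
  unfolding right_deriv_def
  by (rule cINF_lower[OF convex_slope_bdd_below[OF assms(1-3)]]) (use assms in auto)

lemma slope_tendsto_right_deriv:
  fixes x v :: "'a::real_normed_vector"
  assumes "convex_on C f" "open C" "x \<in> C"
  shows "((\<lambda>t. (f (x + t *\<^sub>R v) - f x) / t) \<longlongrightarrow> right_deriv C f x v) (at_right 0)"
proof (rule order_tendstoI)
  have ev: "\<forall>\<^sub>F t in at_right 0. 0 < t \<and> x + t *\<^sub>R v \<in> C"
    by (intro eventually_conj eventually_add_scaleR_mem[OF assms(2,3)] eventually_at_right_less)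
  fix a
  show "\<forall>\<^sub>F t in at_right 0. a < (f (x + t *\<^sub>R v) - f x) / t" if "a < right_deriv C f x v"
    using ev by eventually_elim (use that right_deriv_le_slope[OF assms] in force)
  show "\<forall>\<^sub>F t in at_right 0. (f (x + t *\<^sub>R v) - f x) / t < a" if a: "right_deriv C f x v < a"
  proof -
    have "{t. 0 < t \<and> x + t *\<^sub>R v \<in> C} \<noteq> {}"
      using eventually_happens'[OF trivial_limit_at_right_real ev] by blast
    then obtain t where t: "0 < t" "x + t *\<^sub>R v \<in> C" "(f (x + t *\<^sub>R v) - f x) / t < a"
      using a unfolding right_deriv_def
      by (subst (asm) cINF_less_iff[OF _ convex_slope_bdd_below[OF assms]]) auto
    have "\<forall>\<^sub>F s in at_right 0. s \<in> {0<..<t}"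
      using t(1) by (rule eventually_at_right_real)
    then show ?thesis
      by eventually_elim (use t convex_slope_mono[OF assms(1,3) t(2)] in force)
  qed
qed

text \<open>Stretching the step by a factor \<open>c\<close> multiplies the derivative by \<open>c\<close>; a factor of
  zero is needed for the coordinates in which a direction vanishes.\<close>

lemma scaled_slope_tendsto_right_deriv:
  fixes x v :: "'a::real_normed_vector"
  assumes "convex_on C f" "open C" "x \<in> C" "0 \<le> c"
  shows "((\<lambda>t. (f (x + (t * c) *\<^sub>R v) - f x) / t) \<longlongrightarrow> c * right_deriv C f x v) (at_right 0)"
proof (cases "c = 0")
  case False
  then have c: "0 < c" using assms by simp
  have "filterlim (\<lambda>t. t * c) (at_right 0) (at_right 0)"
    unfolding filterlim_at
  proof
    have "((\<lambda>t. t * c) \<longlongrightarrow> 0 * c) (at_right 0)"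
      by (intro tendsto_intros)
    then show "((\<lambda>t. t * c) \<longlongrightarrow> 0) (at_right 0)" by simp
    show "\<forall>\<^sub>F t in at_right 0. t * c \<in> {0<..} \<and> t * c \<noteq> 0"
      using eventually_at_right_less[of "0::real"] by eventually_elim (use c in auto)
  qed
  then have "((\<lambda>t. c * ((f (x + (t * c) *\<^sub>R v) - f x) / (t * c))) \<longlongrightarrow> c * right_deriv C f x v)
      (at_right 0)"
    by (intro tendsto_mult_left
        filterlim_compose[OF slope_tendsto_right_deriv[OF assms(1-3)]])
  then show ?thesis
    using c by simp
qed simp

section \<open>Increments of 2-box monotone convex functions\<close>

text \<open>On a line, convexity says that the increment over a step of fixed length grows with the
  starting point.\<close>

lemma convex_increment_mono:
  fixes x v :: "'a::real_vector"
  assumes "convex_on C f" "x \<in> C" "x + (s + t) *\<^sub>R v \<in> C" "0 \<le> s" "0 \<le> t"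
  shows "f (x + t *\<^sub>R v) - f x \<le> f (x + (s + t) *\<^sub>R v) - f (x + s *\<^sub>R v)"
proof (cases "s + t = 0")
  case False
  then have st: "0 < s + t" using assms by simp
  let ?y = "x + (s + t) *\<^sub>R v"
  have bound: "f (x + r *\<^sub>R v) \<le> f x + r / (s + t) * (f ?y - f x)"
    if "0 \<le> r" "r \<le> s + t" for r
  proof -
    have eq: "x + r *\<^sub>R v = (1 - r / (s + t)) *\<^sub>R x + (r / (s + t)) *\<^sub>R (x + (s + t) *\<^sub>R v)"
      using st by (simp add: scaleR_diff_left scaleR_add_right del: scaleR_left_distrib
          scaleR_add_left)
    have "f (x + r *\<^sub>R v) \<le> (1 - r / (s + t)) * f x + r / (s + t) * f ?y"
      unfolding eq by (rule convex_onD[OF assms(1)]) (use assms st that in auto)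
    then show ?thesis
      by (simp only: left_diff_distrib right_diff_distrib)
  qed
  have "s / (s + t) * (f ?y - f x) + t / (s + t) * (f ?y - f x) = f ?y - f x"
    using st by (simp flip: distrib_right add_divide_distrib)
  then show ?thesis
    using bound[of s] bound[of t] assms(4,5) by linarith
next
  case True
  then have "s = 0" "t = 0" using assms by auto
  then show ?thesis by simp
qed

text \<open>The other coordinates are where 2-box monotonicity enters. It speaks of nondegenerate boxes
  only, but for a degenerate one the inequality is an equality.\<close>

lemma two_box_increment_mono:
  fixes C :: "(real ^ 'n) set"
  assumes C: "open_box C" and \<Phi>: "two_box_monotone_on C \<Phi>"
    and "i \<noteq> j" "0 \<le> s" "0 \<le> t" "a \<in> C" "a + s *\<^sub>R axis j 1 + t *\<^sub>R axis i 1 \<in> C"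
  shows "\<Phi> (a + t *\<^sub>R axis i 1) - \<Phi> a
    \<le> \<Phi> (a + s *\<^sub>R axis j 1 + t *\<^sub>R axis i 1) - \<Phi> (a + s *\<^sub>R axis j 1)"
proof (cases "s = 0 \<or> t = 0")
  case False
  then have st: "0 < s" "0 < t" using assms by auto
  have sub: "{replace2 a i p j q | p q. p \<in> {a $ i..a $ i + t} \<and> q \<in> {a $ j..a $ j + s}} \<subseteq> C"
  proof clarify
    fix p q assume p: "p \<in> {a $ i..a $ i + t}" and q: "q \<in> {a $ j..a $ j + s}"
    show "replace2 a i p j q \<in> C"
    proof (rule open_box_memI[OF C])
      fix l
      show "\<exists>u\<in>C. \<exists>v\<in>C. u $ l \<le> replace2 a i p j q $ l \<and> replace2 a i p j q $ l \<le> v $ l"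
        by (rule bexI[OF _ \<open>a \<in> C\<close>], rule bexI[OF _ assms(7)])
          (use p q st \<open>i \<noteq> j\<close> in \<open>auto simp: replace2_def axis_def\<close>)
    qed
  qed
  have corners: "replace2 a i (a $ i) j (a $ j) = a"
    "replace2 a i (a $ i) j (a $ j + s) = a + s *\<^sub>R axis j 1"
    "replace2 a i (a $ i + t) j (a $ j) = a + t *\<^sub>R axis i 1"
    "replace2 a i (a $ i + t) j (a $ j + s) = a + s *\<^sub>R axis j 1 + t *\<^sub>R axis i 1"
    using \<open>i \<noteq> j\<close> by (auto simp: replace2_def axis_def vec_eq_iff)
  have "\<Phi> (replace2 a i (a $ i) j (a $ j)) - \<Phi> (replace2 a i (a $ i) j (a $ j + s))
      - \<Phi> (replace2 a i (a $ i + t) j (a $ j)) + \<Phi> (replace2 a i (a $ i + t) j (a $ j + s)) \<ge> 0"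
    using \<Phi> sub st \<open>i \<noteq> j\<close> unfolding two_box_monotone_on_def by simp
  then show ?thesis
    unfolding corners by simp
qed auto

text \<open>To pass from \<open>a\<close> to \<open>b\<close> one coordinate is raised at a time: the coordinate \<open>i\<close> by
  convexity, the others by 2-box monotonicity. All intermediate points lie in the box.\<close>

lemma increment_mono:
  fixes C :: "(real ^ 'n) set"
  assumes C: "open_box C" and \<Phi>: "two_box_monotone_on C \<Phi>" "convex_on C \<Phi>"
    and "0 \<le> t" "a \<le> b" "a \<in> C" "b + t *\<^sub>R axis i 1 \<in> C"
  shows "\<Phi> (a + t *\<^sub>R axis i 1) - \<Phi> a \<le> \<Phi> (b + t *\<^sub>R axis i 1) - \<Phi> b"
proof -
  define m where "m S = (\<chi> l. if l \<in> S then b $ l else a $ l)" for S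
  have ab: "a $ l \<le> b $ l" for l
    using \<open>a \<le> b\<close> by (simp add: less_eq_vec_def)
  have mem: "w \<in> C" if "a \<le> w" "w \<le> b + t *\<^sub>R axis i 1" for w
    using that by (intro open_box_memI[OF C] bexI[OF _ \<open>a \<in> C\<close>] bexI[OF _ assms(7)])
      (auto simp: less_eq_vec_def)
  have "\<Phi> (a + t *\<^sub>R axis i 1) - \<Phi> a \<le> \<Phi> (m S + t *\<^sub>R axis i 1) - \<Phi> (m S)" if "finite S" for S
    using that
  proof (induction S)
    case empty
    have "m {} = a" by (simp add: m_def vec_eq_iff)
    then show ?case by simp
  next
    case (insert j S)
    let ?s = "b $ j - a $ j"
    have m: "m (insert j S) = m S + ?s *\<^sub>R axis j 1"
      using insert.hyps by (auto simp: m_def vec_eq_iff axis_def)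
    have mS: "m S \<in> C"
      using ab \<open>0 \<le> t\<close> by (intro mem) (auto simp: m_def less_eq_vec_def axis_def add_increasing2)
    have mT: "m S + ?s *\<^sub>R axis j 1 + t *\<^sub>R axis i 1 \<in> C"
      unfolding m[symmetric] using ab \<open>0 \<le> t\<close>
      by (intro mem) (auto simp: m_def less_eq_vec_def axis_def add_increasing2)
    have "\<Phi> (m S + t *\<^sub>R axis i 1) - \<Phi> (m S)
        \<le> \<Phi> (m S + ?s *\<^sub>R axis j 1 + t *\<^sub>R axis i 1) - \<Phi> (m S + ?s *\<^sub>R axis j 1)"
    proof (cases "i = j")
      case True
      have eq: "m S + ?s *\<^sub>R axis j 1 + t *\<^sub>R axis j 1 = m S + (?s + t) *\<^sub>R axis j 1"
        by (simp add: scaleR_left_distrib)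
      show ?thesis
        using convex_increment_mono[OF \<Phi>(2) mS, of ?s t "axis j 1"] mT ab[of j] \<open>0 \<le> t\<close>
        unfolding True eq by simp
    next
      case False
      then show ?thesis
        using two_box_increment_mono[OF C \<Phi>(1) _ _ _ mS mT] ab[of j] \<open>0 \<le> t\<close> by simp
    qed
    with insert.IH show ?case
      unfolding m by linarith
  qed
  from this[of UNIV] show ?thesis
    by (simp add: m_def)
qed

text \<open>Adding the coordinates of \<open>w\<close> one after the other, each increment is at least the
  increment of the same step taken from \<open>x\<close>.\<close>

lemma sum_coordinate_increments_le:
  fixes C :: "(real ^ 'n) set"
  assumes C: "open_box C" and \<Phi>: "two_box_monotone_on C \<Phi>" "convex_on C \<Phi>"
    and "0 \<le> w" "x \<in> C" "x + w \<in> C"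
  shows "(\<Sum>i\<in>UNIV. \<Phi> (x + (w $ i) *\<^sub>R axis i 1) - \<Phi> x) \<le> \<Phi> (x + w) - \<Phi> x"
proof -
  define m where "m S = (\<chi> l. if l \<in> S then w $ l else 0)" for S
  have w: "0 \<le> w $ l" for l
    using \<open>0 \<le> w\<close> by (simp add: less_eq_vec_def)
  have "(\<Sum>i\<in>S. \<Phi> (x + (w $ i) *\<^sub>R axis i 1) - \<Phi> x) \<le> \<Phi> (x + m S) - \<Phi> x" if "finite S" for S
    using that
  proof (induction S)
    case empty
    have "m {} = 0" by (simp add: m_def vec_eq_iff)
    then show ?case by simp
  next
    case (insert j S)
    have m: "x + m (insert j S) = x + m S + (w $ j) *\<^sub>R axis j 1"
      using insert.hyps by (auto simp: m_def vec_eq_iff axis_def)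
    have "x + m (insert j S) \<in> C"
      using w by (intro open_box_memI[OF C] bexI[OF _ \<open>x \<in> C\<close>] bexI[OF _ assms(6)])
        (auto simp: m_def)
    then have "\<Phi> (x + (w $ j) *\<^sub>R axis j 1) - \<Phi> x \<le> \<Phi> (x + m (insert j S)) - \<Phi> (x + m S)"
      unfolding m using w \<open>x \<in> C\<close>
      by (intro increment_mono[OF C \<Phi>]) (auto simp: m_def less_eq_vec_def)
    with insert show ?case
      by simp
  qed
  from this[of UNIV] show ?thesis
    by (simp add: m_def)
qed

text \<open>In the opposite direction convexity alone suffices: \<open>x + w\<close> is the barycentre of the points
  reached by \<open>CARD('n)\<close>-fold steps along the axes.\<close>

lemma increment_le_sum_coordinate_increments:
  fixes w x :: "real ^ 'n"
  assumes "convex_on C \<Phi>" and "\<And>i. x + (CARD('n) * w $ i) *\<^sub>R axis i 1 \<in> C"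
  shows "\<Phi> (x + w) - \<Phi> x
    \<le> (\<Sum>i\<in>UNIV. (\<Phi> (x + (CARD('n) * w $ i) *\<^sub>R axis i 1) - \<Phi> x) / CARD('n))"
proof -
  have eq: "(\<Sum>i\<in>UNIV. (1 / CARD('n)) *\<^sub>R (x + (CARD('n) * w $ i) *\<^sub>R axis i 1)) = x + w"
    using basis_expansion[of w]
    by (simp add: scaleR_add_right sum.distrib sum_constant_scaleR scalar_mult_eq_scaleR
        del: sum_constant)
  have "\<Phi> (\<Sum>i\<in>UNIV. (1 / CARD('n)) *\<^sub>R (x + (CARD('n) * w $ i) *\<^sub>R axis i 1))
      \<le> (\<Sum>i\<in>UNIV. 1 / CARD('n) * \<Phi> (x + (CARD('n) * w $ i) *\<^sub>R axis i 1))"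
    by (rule convex_on_sum) (use assms in \<open>auto intro: convex_on_imp_convex\<close>)
  then show ?thesis
    unfolding eq by (simp add: diff_divide_distrib sum_subtractf)
qed

section \<open>An isotone subgradient\<close>

lemma right_partial_mono:
  fixes C :: "(real ^ 'n) set"
  assumes C: "open_box C" and \<Phi>: "two_box_monotone_on C \<Phi>" "convex_on C \<Phi>"
    and "x \<in> C" "z \<in> C" "x \<le> z"
  shows "right_deriv C \<Phi> x (axis i 1) \<le> right_deriv C \<Phi> z (axis i 1)"
proof (rule tendsto_le[OF trivial_limit_at_right_real])
  note op = open_box_imp_open[OF C]
  show "((\<lambda>t. (\<Phi> (z + t *\<^sub>R axis i 1) - \<Phi> z) / t) \<longlongrightarrow> right_deriv C \<Phi> z (axis i 1)) (at_right 0)"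
    "((\<lambda>t. (\<Phi> (x + t *\<^sub>R axis i 1) - \<Phi> x) / t) \<longlongrightarrow> right_deriv C \<Phi> x (axis i 1)) (at_right 0)"
    using slope_tendsto_right_deriv[OF \<Phi>(2) op] \<open>x \<in> C\<close> \<open>z \<in> C\<close> by auto
  show "\<forall>\<^sub>F t in at_right 0. (\<Phi> (x + t *\<^sub>R axis i 1) - \<Phi> x) / t \<le> (\<Phi> (z + t *\<^sub>R axis i 1) - \<Phi> z) / t"
    using eventually_add_scaleR_mem[OF op \<open>z \<in> C\<close>, of "axis i 1"] eventually_at_right_less
  proof eventually_elim
    case (elim t)
    then show ?case
      using increment_mono[OF C \<Phi> _ \<open>x \<le> z\<close> \<open>x \<in> C\<close>, of t i] by (intro divide_right_mono) auto
  qed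
qed

text \<open>This is the inequality \<open>D h \<ge> D h\<^sup>+ - D h\<^sup>-\<close> for the directional derivative \<open>D\<close>
  at \<open>x\<close>, carried out for difference quotients.\<close>

lemma right_partials_subgradient:
  fixes C :: "(real ^ 'n) set"
  assumes C: "open_box C" and \<Phi>: "two_box_monotone_on C \<Phi>" "convex_on C \<Phi>"
    and x: "x \<in> C" and z: "z \<in> C"
  shows "(\<chi> i. right_deriv C \<Phi> x (axis i 1)) \<bullet> (z - x) \<le> \<Phi> z - \<Phi> x"
proof -
  note op = open_box_imp_open[OF C]
  define h where "h = z - x"
  define hp where "hp = (\<chi> i. max (h $ i) 0)"
  define hm where "hm = (\<chi> i. max (- h $ i) 0)"
  define d where "d i = right_deriv C \<Phi> x (axis i 1)" for i
  have h: "h = hp - hm"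
    by (auto simp: vec_eq_iff hp_def hm_def max_def)
  have hp0: "0 \<le> hp $ i" and hm0: "0 \<le> hm $ i" for i
    by (auto simp: hp_def hm_def)
  have dle: "s * d i \<le> \<Phi> (x + s *\<^sub>R axis i 1) - \<Phi> x"
    if "0 \<le> s" "x + s *\<^sub>R axis i 1 \<in> C" for s i
    using that right_deriv_le_slope[OF \<Phi>(2) op x, of s "axis i 1"]
    by (cases "s = 0") (auto simp: d_def field_simps)
  \<comment> \<open>\<open>L t\<close> plays the part of \<open>D h\<^sup>+ - D h\<^sup>-\<close>: the bound for \<open>h\<^sup>+\<close> is exact for every step,
    only the one for \<open>h\<^sup>-\<close> needs a limit.\<close>
  define L where "L t = (\<Sum>i\<in>UNIV. hp $ i * d i)
    - (\<Sum>i\<in>UNIV. (\<Phi> (x + (t * (CARD('n) * hm $ i)) *\<^sub>R axis i 1) - \<Phi> x) / t / CARD('n))" for t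
  have "(L \<longlongrightarrow> (\<Sum>i\<in>UNIV. hp $ i * d i) - (\<Sum>i\<in>UNIV. (CARD('n) * hm $ i) * d i / CARD('n)))
      (at_right 0)"
    unfolding L_def d_def
    by (intro tendsto_intros scaled_slope_tendsto_right_deriv[OF \<Phi>(2) op x]) (use hm0 in auto)
  moreover have "(\<Sum>i\<in>UNIV. hp $ i * d i) - (\<Sum>i\<in>UNIV. (CARD('n) * hm $ i) * d i / CARD('n))
      = (\<chi> i. d i) \<bullet> h"
    by (simp add: inner_vec_def h sum_subtractf[symmetric] algebra_simps)
  ultimately have lim: "(L \<longlongrightarrow> (\<chi> i. d i) \<bullet> h) (at_right 0)"
    by simp
  have "\<forall>\<^sub>F t in at_right 0. L t \<le> \<Phi> z - \<Phi> x"
  proof -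
    have ev: "\<forall>\<^sub>F t in at_right 0. \<forall>i. x + t *\<^sub>R (CARD('n) * hm $ i) *\<^sub>R axis i 1 \<in> C"
      by (intro eventually_all_finite eventually_add_scaleR_mem[OF op x])
    have "\<forall>\<^sub>F t in at_right 0. t \<in> {0<..<1::real}"
      by (rule eventually_at_right_real) simp
    then show ?thesis
      using ev eventually_add_scaleR_mem[OF op x, of hp] eventually_add_scaleR_mem[OF op x, of hm]
    proof eventually_elim
      case (elim t)
      then have t: "0 < t" "t < 1" by auto
      have eqz: "x + 1 *\<^sub>R h = z" by (simp add: h_def)
      have th: "x + t *\<^sub>R h \<in> C"
      proof -
        have "x + t *\<^sub>R h = (1 - t) *\<^sub>R x + t *\<^sub>R z"
          by (simp add: h_def algebra_simps)
        then show ?thesis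
          using convex_on_imp_convex[OF \<Phi>(2)] x z t by (simp add: convex_alt)
      qed
      \<comment> \<open>Subadditivity \<open>D h\<^sup>+ \<le> D h + D h\<^sup>-\<close> is convexity at this midpoint, whence the step
        \<open>t / 2\<close> in direction \<open>h\<^sup>+\<close>.\<close>
      have half: "x + (t / 2) *\<^sub>R hp = (1 - 1/2) *\<^sub>R (x + t *\<^sub>R h) + (1/2) *\<^sub>R (x + t *\<^sub>R hm)"
        unfolding h by (simp add: vec_eq_iff field_simps)
      have halfC: "x + (t / 2) *\<^sub>R hp \<in> C"
        unfolding half by (rule convexD_alt[OF convex_on_imp_convex[OF \<Phi>(2)] th elim(4)]) auto
      have conv: "\<Phi> (x + (t / 2) *\<^sub>R hp)
          \<le> (1 - 1/2) * \<Phi> (x + t *\<^sub>R h) + (1/2) * \<Phi> (x + t *\<^sub>R hm)"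
        unfolding half by (rule convex_onD[OF \<Phi>(2)]) (use th elim(4) in auto)
      have pos: "(\<Sum>i\<in>UNIV. t / 2 * hp $ i * d i) \<le> \<Phi> (x + (t / 2) *\<^sub>R hp) - \<Phi> x"
      proof -
        have "(\<Sum>i\<in>UNIV. t / 2 * hp $ i * d i)
            \<le> (\<Sum>i\<in>UNIV. \<Phi> (x + (((t / 2) *\<^sub>R hp) $ i) *\<^sub>R axis i 1) - \<Phi> x)"
        proof (rule sum_mono)
          fix i
          have "x + (((t / 2) *\<^sub>R hp) $ i) *\<^sub>R axis i 1 \<in> C"
            using hp0 t by (intro open_box_memI[OF C] bexI[OF _ x] bexI[OF _ halfC])
              (auto simp: axis_def)
          then show "t / 2 * hp $ i * d i \<le> \<Phi> (x + (((t / 2) *\<^sub>R hp) $ i) *\<^sub>R axis i 1) - \<Phi> x"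
            using dle[of "((t / 2) *\<^sub>R hp) $ i" i] hp0 t by simp
        qed
        also have "\<dots> \<le> \<Phi> (x + (t / 2) *\<^sub>R hp) - \<Phi> x"
          by (rule sum_coordinate_increments_le[OF C \<Phi> _ x halfC])
            (use hp0 t in \<open>auto simp: less_eq_vec_def\<close>)
        finally show ?thesis .
      qed
      have comm: "CARD('n) * (t *\<^sub>R hm) $ i = t * (CARD('n) * hm $ i)" for i
        by simp
      have neg: "\<Phi> (x + t *\<^sub>R hm) - \<Phi> x
          \<le> (\<Sum>i\<in>UNIV. (\<Phi> (x + (t * (CARD('n) * hm $ i)) *\<^sub>R axis i 1) - \<Phi> x) / CARD('n))"
        using increment_le_sum_coordinate_increments[OF \<Phi>(2), of x "t *\<^sub>R hm"] elim(2)
        unfolding comm by (simp add: mult.assoc)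
      have "t * L t = 2 * (\<Sum>i\<in>UNIV. t / 2 * hp $ i * d i)
          - (\<Sum>i\<in>UNIV. (\<Phi> (x + (t * (CARD('n) * hm $ i)) *\<^sub>R axis i 1) - \<Phi> x) / CARD('n))"
        unfolding L_def right_diff_distrib sum_distrib_left using t by (simp add: mult.assoc)
      also have "\<dots> \<le> \<Phi> (x + t *\<^sub>R h) - \<Phi> x"
        using conv pos neg by simp
      finally have "L t \<le> (\<Phi> (x + t *\<^sub>R h) - \<Phi> x) / t"
        using t by (simp add: field_simps)
      also have "\<dots> \<le> (\<Phi> (x + 1 *\<^sub>R h) - \<Phi> x) / 1"
        by (rule convex_slope_mono[OF \<Phi>(2) x]) (use t z eqz in auto)
      finally show ?case
        unfolding eqz by simp
    qed
  qed
  from tendsto_upperbound[OF lim this trivial_limit_at_right_real] show ?thesis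
    unfolding d_def h_def .
qed

lemma isotone_subgradient:
  fixes C :: "(real ^ 'n) set"
  assumes "open_box C" "two_box_monotone_on C \<Phi>" "convex_on C \<Phi>"
  obtains p :: "real ^ 'n \<Rightarrow> real ^ 'n"
    where "\<And>x z. x \<in> C \<Longrightarrow> z \<in> C \<Longrightarrow> p x \<bullet> (z - x) \<le> \<Phi> z - \<Phi> x"
      and "\<And>x z. x \<in> C \<Longrightarrow> z \<in> C \<Longrightarrow> x \<le> z \<Longrightarrow> p x \<le> p z"
proof
  let ?p = "\<lambda>x. \<chi> i. right_deriv C \<Phi> x (axis i 1)"
  show "?p x \<bullet> (z - x) \<le> \<Phi> z - \<Phi> x" if "x \<in> C" "z \<in> C" for x z
    using right_partials_subgradient[OF assms that] .
  show "?p x \<le> ?p z" if "x \<in> C" "z \<in> C" "x \<le> z" for x z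
    using right_partial_mono[OF assms that] by (simp add: less_eq_vec_def)
qed

section \<open>Summation by parts\<close>

text \<open>Replacing \<open>p N\<close> by the smaller \<open>p (Suc N)\<close> lowers the product with the nonnegative
  partial sum. The term on the left keeps the bound inductive; it vanishes when the total is
  zero.\<close>

lemma antimono_weighted_sum_ge:
  fixes p d :: "nat \<Rightarrow> real ^ 'n"
  assumes "\<And>k. k \<in> {1..<N} \<Longrightarrow> p (Suc k) \<le> p k"
    and "\<And>n. n \<in> {1..<N} \<Longrightarrow> 0 \<le> (\<Sum>k=1..n. d k)"
  shows "p N \<bullet> (\<Sum>k=1..N. d k) \<le> (\<Sum>k=1..N. p k \<bullet> d k)"
  using assms
proof (induction N)
  case (Suc N)
  have "p (Suc N) \<bullet> (\<Sum>k=1..N. d k) \<le> p N \<bullet> (\<Sum>k=1..N. d k)"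
  proof (cases "N = 0")
    case False
    then have "p (Suc N) \<le> p N" "0 \<le> (\<Sum>k=1..N. d k)"
      using Suc.prems[of N] by auto
    then show ?thesis
      unfolding inner_vec_def
      by (intro sum_mono) (auto simp: less_eq_vec_def intro: mult_right_mono)
  qed simp
  also have "\<dots> \<le> (\<Sum>k=1..N. p k \<bullet> d k)"
    using Suc by simp
  finally show ?case
    by (simp add: inner_add_right)
qed simp

lemma majorized_antimono_sum_nonneg:
  fixes p x y :: "nat \<Rightarrow> real ^ 'n"
  assumes "weighted_sums_dominated N lam x y"
    and "\<And>k. k \<in> {1..<N} \<Longrightarrow> p (Suc k) \<le> p k"
  shows "0 \<le> (\<Sum>k=1..N. lam k * (p k \<bullet> (y k - x k)))"
proof -
  let ?d = "\<lambda>k. lam k *\<^sub>R (y k - x k)"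
  have d: "(\<Sum>k=1..n. ?d k) = (\<Sum>k=1..n. lam k *\<^sub>R y k) - (\<Sum>k=1..n. lam k *\<^sub>R x k)" for n
    by (simp add: scaleR_diff_right sum_subtractf)
  have "p N \<bullet> (\<Sum>k=1..N. ?d k) \<le> (\<Sum>k=1..N. p k \<bullet> ?d k)"
    by (rule antimono_weighted_sum_ge)
      (use assms in \<open>auto simp: d weighted_sums_dominated_def simp del: One_nat_def\<close>)
  moreover have "(\<Sum>k=1..N. ?d k) = 0"
    using assms(1) unfolding d weighted_sums_dominated_def by simp
  ultimately show ?thesis
    by simp
qed

section \<open>The majorization inequalities\<close>

theorem theorem6:
  fixes C :: "(real ^ 'n) set"
    and N :: nat
    and lam :: "nat \<Rightarrow> real"
    and x y :: "nat \<Rightarrow> real ^ 'n"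
  assumes "CARD('n) \<ge> 2"
    and "open_box C"
    and "C \<subseteq> {z. \<forall>i. 0 < z $ i}"
    and "\<And>k. k \<in> {1..N} \<Longrightarrow> lam k \<in> {0<..1}"
    and "(\<Sum>k=1..N. lam k) = 1"
    and "\<And>k. k \<in> {1..N} \<Longrightarrow> x k \<in> C"
    and "\<And>k. k \<in> {1..N} \<Longrightarrow> y k \<in> C"
  shows "(majorized_L_down N lam x y \<longrightarrow>
            (\<forall>\<Phi>. two_box_monotone_on C \<Phi> \<and> convex_on C \<Phi> \<longrightarrow>
               (\<Sum>k=1..N. lam k * \<Phi> (y k)) \<ge> (\<Sum>k=1..N. lam k * \<Phi> (x k)))) \<and>
         (majorized_R_up N lam x y \<longrightarrow>
            (\<forall>\<Phi>. two_box_monotone_on C \<Phi> \<and> convex_on C \<Phi> \<longrightarrow>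
               (\<Sum>k=1..N. lam k * \<Phi> (y k)) \<le> (\<Sum>k=1..N. lam k * \<Phi> (x k))))"
proof (intro conjI impI allI; elim conjE)
  fix \<Phi> assume maj: "majorized_L_down N lam x y" and \<Phi>: "two_box_monotone_on C \<Phi>" "convex_on C \<Phi>"
  obtain p where p: "\<And>x z. x \<in> C \<Longrightarrow> z \<in> C \<Longrightarrow> p x \<bullet> (z - x) \<le> \<Phi> z - \<Phi> x"
    and mono: "\<And>x z. x \<in> C \<Longrightarrow> z \<in> C \<Longrightarrow> x \<le> z \<Longrightarrow> p x \<le> p z"
    using isotone_subgradient[OF assms(2) \<Phi>] by blast
  have "0 \<le> (\<Sum>k=1..N. lam k * (p (x k) \<bullet> (y k - x k)))"
    by (rule majorized_antimono_sum_nonneg)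
      (use maj assms(6) in \<open>auto simp: majorized_L_down_def intro!: mono\<close>)
  also have "\<dots> \<le> (\<Sum>k=1..N. lam k * (\<Phi> (y k) - \<Phi> (x k)))"
    by (intro sum_mono mult_left_mono p) (use assms(4,6,7) in \<open>auto intro: less_imp_le\<close>)
  finally show "(\<Sum>k=1..N. lam k * \<Phi> (x k)) \<le> (\<Sum>k=1..N. lam k * \<Phi> (y k))"
    by (simp add: right_diff_distrib sum_subtractf)
next
  fix \<Phi> assume maj: "majorized_R_up N lam x y" and \<Phi>: "two_box_monotone_on C \<Phi>" "convex_on C \<Phi>"
  obtain p where p: "\<And>x z. x \<in> C \<Longrightarrow> z \<in> C \<Longrightarrow> p x \<bullet> (z - x) \<le> \<Phi> z - \<Phi> x"
    and mono: "\<And>x z. x \<in> C \<Longrightarrow> z \<in> C \<Longrightarrow> x \<le> z \<Longrightarrow> p x \<le> p z"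
    using isotone_subgradient[OF assms(2) \<Phi>] by blast
  have "p (y k) \<le> p (y (Suc k))" if "k \<in> {1..<N}" for k
    using that maj assms(7) by (intro mono) (auto simp: majorized_R_up_def)
  \<comment> \<open>The \<open>p (y k)\<close> increase, so it is their negatives to which summation by parts applies.\<close>
  then have "0 \<le> (\<Sum>k=1..N. lam k * (- p (y k) \<bullet> (y k - x k)))"
    by (intro majorized_antimono_sum_nonneg)
      (use maj in \<open>auto simp: majorized_R_up_def less_eq_vec_def\<close>)
  also have "\<dots> = (\<Sum>k=1..N. lam k * (p (y k) \<bullet> (x k - y k)))"
    by (simp add: inner_diff_right)
  also have "\<dots> \<le> (\<Sum>k=1..N. lam k * (\<Phi> (x k) - \<Phi> (y k)))"
    by (intro sum_mono mult_left_mono p) (use assms(4,6,7) in \<open>auto intro: less_imp_le\<close>)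
  finally show "(\<Sum>k=1..N. lam k * \<Phi> (y k)) \<le> (\<Sum>k=1..N. lam k * \<Phi> (x k))"
    by (simp add: right_diff_distrib sum_subtractf)
qed

end
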